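(* Let $\Gamma_1$ and $\Gamma_2$ be numerical semigroups and let $\Gamma=\Gamma_1\#_{\lambda,\mu}\Gamma_2$ be a gluing of $\Gamma_1$ and $\Gamma_2$. If $\mathrm{res}(\Gamma_1)\le g(\Gamma_1)-n(\Gamma_1)$ and $\mathrm{res}(\Gamma_2)\le g(\Gamma_2)-n(\Gamma_2)$, then $\mathrm{res}(\Gamma)\le g(\Gamma)-n(\Gamma)$.
   Context: $\mathbb{K}$ is a field. A numerical semigroup $H$ is a submonoid of $\mathbb{N}$ (non-negative integers) with finite complement; numerical semigroups are assumed to have more than one minimal generator. $\mathrm{F}(H)$ is the largest integer in $\mathbb{N}\setminus H$, $g(H)=|\mathbb{N}\setminus H|$, and $n(H)=|\{s\in H: s<\mathrm{F}(H)\}|$. $\mathbb{K}[H]\subset\mathbb{K}[t]$ is the semigroup ring spanned by the $t^h$, $h\in H$, $\omega_{\mathbb{K}[H]}$ is its canonical module, and $\mathrm{tr}(\omega_{\mathbb{K}[H]})=\sum_{\phi\in\mathrm{Hom}(\omega_{\mathbb{K}[H]},\mathbb{K}[H])}\phi(\omega_{\mathbb{K}[H]})$ is its trace ideal. The residue is $\mathrm{res}(H)=\dim_{\mathbb{K}}\mathbb{K}[H]/\mathrm{tr}(\omega_{\mathbb{K}[H]})$. Gluing: let $\Gamma_1$ be minimally generated by $m_1<\dots<m_l$ and $\Gamma_2$ by $n_1<\dots<n_k$. Let $\lambda\in\Gamma_1$, $\mu\in\Gamma_2$ be positive integers with $\gcd(\lambda,\mu)=1$, $\lambda\notin\{m_1,\dots,m_l\}$,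 $\mu\notin\{n_1,\dots,n_k\}$ and $\{\mu m_1,\dots,\mu m_l\}\cap\{\lambda n_1,\dots,\lambda n_k\}=\emptyset$. The gluing with respect to $\mu$ and $\lambda$ is $\Gamma_1\#_{\lambda,\mu}\Gamma_2=\langle\mu m_1,\dots,\mu m_l,\lambda n_1,\dots,\lambda n_k\rangle$. *)

theory Defs
  imports Complex_Main "HOL-Library.Poly_Mapping" "HOL-Library.Function_Algebras"
begin

subsection \<open>Numerical semigroups\<close>

definition add_submonoid :: "nat set \<Rightarrow> bool" where
  "add_submonoid H \<longleftrightarrow> 0 \<in> H \<and> (\<forall>a\<in>H. \<forall>b\<in>H. a + b \<in> H)"

definition generated_monoid :: "nat set \<Rightarrow> nat set" where
  "generated_monoid A = add_submonoid hull A"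

definition minimal_generators :: "nat set \<Rightarrow> nat set \<Rightarrow> bool" where
  "minimal_generators A H \<longleftrightarrow>
     generated_monoid A = H \<and> (\<forall>B. B \<subset> A \<longrightarrow> generated_monoid B \<noteq> H)"

text \<open>The last conjunct of the following definition is the convention that there is more than one
  minimal generator (the minimal generating set being finite and unique); it excludes only the
  monoid of all natural numbers, so that the Frobenius number is a natural number.\<close>

definition numerical_semigroup :: "nat set \<Rightarrow> bool" where
  "numerical_semigroup H \<longleftrightarrow>
     add_submonoid H \<and> finite (UNIV - H) \<and> (\<exists>A. minimal_generators A H \<and> card A > 1)"

definition frobenius_number :: "nat set \<Rightarrow> nat" where
  "frobenius_number H = Max (UNIV - H)"

definition semigroup_genus :: "nat set \<Rightarrow> nat" where
  "semigroup_genus H = card (UNIV - H)"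

definition small_elements :: "nat set \<Rightarrow> nat" where
  "small_elements H = card {s \<in> H. s < frobenius_number H}"

definition is_gluing :: "nat \<Rightarrow> nat \<Rightarrow> nat set \<Rightarrow> nat set \<Rightarrow> nat set \<Rightarrow> bool" where
  "is_gluing l m \<Gamma>\<^sub>1 \<Gamma>\<^sub>2 \<Gamma> \<longleftrightarrow>
     (\<exists>M N. minimal_generators M \<Gamma>\<^sub>1 \<and> minimal_generators N \<Gamma>\<^sub>2 \<and>
        l \<in> \<Gamma>\<^sub>1 \<and> m \<in> \<Gamma>\<^sub>2 \<and> 0 < l \<and> 0 < m \<and> coprime l m \<and> l \<notin> M \<and> m \<notin> N \<and>
        ((*) m ` M) \<inter> ((*) l ` N) = {} \<and>
        \<Gamma> = generated_monoid (((*) m ` M) \<union> ((*) l ` N)))"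

subsection \<open>Trace ideals\<close>

text \<open>\<open>R\<close> is the carrier of a subring of a commutative ring, and \<open>M\<close> the carrier of an
  \<open>R\<close>-module with action \<open>act\<close>. Homomorphisms are only specified on \<open>M\<close>.\<close>

definition hom_to_ring ::
  "'r::comm_ring_1 set \<Rightarrow> ('r \<Rightarrow> 'm \<Rightarrow> 'm) \<Rightarrow> 'm::ab_group_add set \<Rightarrow> ('m \<Rightarrow> 'r) set" where
  "hom_to_ring R act M =
     {\<phi>. (\<forall>x\<in>M. \<phi> x \<in> R) \<and> (\<forall>x\<in>M. \<forall>y\<in>M. \<phi> (x + y) = \<phi> x + \<phi> y) \<and>
         (\<forall>r\<in>R. \<forall>x\<in>M. \<phi> (act r x) = r * \<phi> x)}"

definition trace_ideal ::
  "'r::comm_ring_1 set \<Rightarrow> ('r \<Rightarrow> 'm \<Rightarrow> 'm) \<Rightarrow> 'm::ab_group_add set \<Rightarrow> 'r set" where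
  "trace_ideal R act M =
     {sum_list xs |xs. set xs \<subseteq> (\<Union>\<phi>\<in>hom_to_ring R act M. \<phi> ` M)}"

subsection \<open>Semigroup rings and their canonical modules\<close>

text \<open>Laurent polynomials \<open>K[t, t\<^sup>-\<^sup>1]\<close>; the monomial \<open>t\<^sup>n\<close> is \<open>Poly_Mapping.single n 1\<close>.\<close>

type_synonym 'k laurent = "int \<Rightarrow>\<^sub>0 'k"

definition laurent_scale :: "'k::field \<Rightarrow> 'k laurent \<Rightarrow> 'k laurent" where
  "laurent_scale c f = Poly_Mapping.single 0 c * f"

interpretation laurent: vector_space "laurent_scale :: 'k::field \<Rightarrow> 'k laurent \<Rightarrow> 'k laurent"
proof
  fix a b :: 'k and x y :: "'k laurent"
  show "laurent_scale a (x + y) = laurent_scale a x + laurent_scale a y"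
    by (simp add: laurent_scale_def distrib_left)
  show "laurent_scale (a + b) x = laurent_scale a x + laurent_scale b x"
    by (simp add: laurent_scale_def single_add distrib_right)
  show "laurent_scale a (laurent_scale b x) = laurent_scale (a * b) x"
    by (simp add: laurent_scale_def mult_single flip: mult.assoc)
  show "laurent_scale 1 x = x"
    by (simp add: laurent_scale_def)
qed

text \<open>\<open>quotient_basis V W B\<close>: for subspaces \<open>W \<subseteq> V\<close>, the classes modulo \<open>W\<close> of the
  elements of \<open>B\<close> are pairwise distinct and form a basis of \<open>V / W\<close>. As with the library's
  \<open>dim\<close>, the dimension is 0 by convention if \<open>V / W\<close> is infinite-dimensional.\<close>

definition quotient_basis ::
  "'k::field laurent set \<Rightarrow> 'k laurent set \<Rightarrow> 'k laurent set \<Rightarrow> bool" where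
  "quotient_basis V W B \<longleftrightarrow>
     B \<subseteq> V \<and> V \<subseteq> {w + s |w s. w \<in> W \<and> s \<in> laurent.span B} \<and>
     (\<forall>A u. finite A \<longrightarrow> A \<subseteq> B \<longrightarrow> (\<Sum>b\<in>A. laurent_scale (u b) b) \<in> W \<longrightarrow> (\<forall>b\<in>A. u b = 0))"

definition quotient_dim :: "'k::field laurent set \<Rightarrow> 'k laurent set \<Rightarrow> nat" where
  "quotient_dim V W = card (SOME B. quotient_basis V W B)"

definition semigroup_ring :: "nat set \<Rightarrow> 'k::field laurent set" where
  "semigroup_ring H = {f. Poly_Mapping.keys f \<subseteq> int ` H}"

text \<open>The canonical module of the graded ring \<open>R = K[H]\<close> is the graded \<open>K\<close>-dual of the local
  cohomology \<open>H\<^sup>1\<^sub>\<mm>(R)\<close> at the graded maximal ideal (Goto--Watanabe). For a positive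
  \<open>e \<in> H\<close> the element \<open>t\<^sup>e\<close> is a parameter and \<open>R[t\<^sup>-\<^sup>e] = K[t, t\<^sup>-\<^sup>1]\<close>, so
  \<open>H\<^sup>1\<^sub>\<mm>(R) = K[t, t\<^sup>-\<^sup>1] / R\<close> by the Cech complex. An element of the graded dual is thus a
  linear functional on \<open>K[t, t\<^sup>-\<^sup>1]\<close> that vanishes on \<open>R\<close> and in all but finitely many
  degrees. Sending \<open>\<phi>\<close> to the sum of all \<open>\<phi>(t\<^sup>n) t\<^sup>-\<^sup>n\<close> identifies this module with the
  fractional ideal spanned by the \<open>t\<^sup>-\<^sup>n\<close>, where \<open>n\<close> ranges over the integers not in \<open>H\<close>.\<close>

definition canonical_module :: "nat set \<Rightarrow> ('k::field laurent \<Rightarrow> 'k) set" where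
  "canonical_module H =
     {\<phi>. Vector_Spaces.linear laurent_scale (*) \<phi> \<and>
         (\<forall>f\<in>semigroup_ring H. \<phi> f = 0) \<and>
         finite {n. \<phi> (Poly_Mapping.single n 1) \<noteq> 0}}"

definition dual_action ::
  "'k::field laurent \<Rightarrow> ('k laurent \<Rightarrow> 'k) \<Rightarrow> ('k laurent \<Rightarrow> 'k)" where
  "dual_action r \<phi> = (\<lambda>f. \<phi> (r * f))"

definition canonical_trace :: "nat set \<Rightarrow> 'k::field laurent set" where
  "canonical_trace H = trace_ideal (semigroup_ring H) dual_action (canonical_module H)"

text \<open>The type argument is the ground field.\<close>

definition semigroup_residue :: "'k::field itself \<Rightarrow> nat set \<Rightarrow> nat" where
  "semigroup_residue _ H =
     quotient_dim (semigroup_ring H :: 'k laurent set) (canonical_trace H)"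

end

theory Submission
  imports Defs
begin

text \<open>
  Write \<open>G\<close> for a numerical semigroup inside the integers, \<open>F\<close> for its largest gap,
  \<open>K = {z. F - z \<notin> G}\<close> for its standard canonical ideal and \<open>\<Omega> = {- z |z. z \<notin> G}\<close> for the
  shift of \<open>K\<close> by \<open>- F\<close>, the degrees of the canonical module. Both sides of the inequality
  are sizes of differences of such sets. Reflection at \<open>F\<close> maps the gaps onto \<open>K \<inter> [0, F]\<close>, so
  that genus minus number of small elements is the size of \<open>K - G\<close>
  (\<open>genus_minus_small_elements\<close>). A homomorphism from the canonical module to the ring is
  multiplication by a Laurent polynomial, so the trace is spanned by the monomials with exponents
  in \<open>T = D + \<Omega>\<close>, where \<open>D\<close> is the set of all \<open>d\<close> with \<open>d + \<Omega> \<subseteq> G\<close>, and the residue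
  is the size of \<open>G - T\<close> (\<open>semigroup_residue_eq\<close>). In particular it does not depend on the
  field.

  The gluing of \<open>G1\<close> and \<open>G2\<close> is the weighted sum \<open>m G1 + l G2\<close>. Its gaps are the numbers
  \<open>m a + l b + l m\<close> with \<open>a\<close> a gap of \<open>G1\<close> and \<open>b\<close> a gap of \<open>G2\<close> (\<open>gap_iff\<close>), whence
  \<open>K = m K1 + l K2\<close> and \<open>T \<supseteq> m T1 + l T2\<close>. The gluing is free over each of its two factors: with
  the Apery set of \<open>G2\<close> with respect to \<open>m\<close> as a basis of \<open>m\<close> elements over \<open>G1\<close>, and with
  \<open>l\<close> basis elements over \<open>G2\<close>. The same counting applies to sets that are merely stable under
  addition of \<open>G1\<close> or \<open>G2\<close>. Replacing the two summands one after the other gives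

  \<open>|(m A + l B) - (m A' + l B')| = m |A - A'| + l |B - B'|\<close>

  (\<open>card_weighted_sum_diff_both\<close>). For \<open>A = K1, A' = G1, B = K2, B' = G2\<close> this says that genus
  minus small elements of the gluing is \<open>m\<close> times that of \<open>G1\<close> plus \<open>l\<close> times that of \<open>G2\<close>. For
  \<open>A = G1, A' = T1, B = G2, B' = T2\<close> it bounds the residue by the same combination of the
  residues, and the two hypotheses can be added up with weights \<open>m\<close> and \<open>l\<close>.
\<close>

section \<open>Numerical semigroups as sets of integers\<close>

text \<open>The largest gap \<open>F\<close> is a parameter. It equals \<open>- 1\<close> when \<open>G\<close> consists of all natural
  numbers.\<close>

locale int_semigroup =
  fixes G :: "int set" and F :: int
  assumes zero: "0 \<in> G"
    and add: "a \<in> G \<Longrightarrow> b \<in> G \<Longrightarrow> a + b \<in> G"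
    and nonneg: "a \<in> G \<Longrightarrow> 0 \<le> a"
    and F_gap: "F \<notin> G"
    and above_F: "F < z \<Longrightarrow> z \<in> G"

definition canonical_degrees :: "int set \<Rightarrow> int set" where
  "canonical_degrees G = {w. - w \<notin> G}"

text \<open>The degrees of homomorphisms from the canonical module to the ring.\<close>

definition dual_degrees :: "int set \<Rightarrow> int set" where
  "dual_degrees G = {d. \<forall>w\<in>canonical_degrees G. d + w \<in> G}"

definition trace_degrees :: "int set \<Rightarrow> int set" where
  "trace_degrees G = {d + w |d w. d \<in> dual_degrees G \<and> w \<in> canonical_degrees G}"

definition standard_canonical :: "int set \<Rightarrow> int \<Rightarrow> int set" where
  "standard_canonical G F = {z. F - z \<notin> G}"

context int_semigroup
begin

lemma canonical_degrees_add:
  assumes "w \<in> canonical_degrees G" "g \<in> G" shows "w + g \<in> canonical_degrees G"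
proof -
  have "- (w + g) \<notin> G"
  proof
    assume "- (w + g) \<in> G"
    from add[OF this assms(2)] assms(1) show False by (simp add: canonical_degrees_def)
  qed
  thus ?thesis by (simp add: canonical_degrees_def)
qed

lemma canonical_degrees_ge: "w \<in> canonical_degrees G \<Longrightarrow> - F \<le> w"
  using above_F[of "- w"] by (force simp: canonical_degrees_def)

lemma trace_degrees_subset: "trace_degrees G \<subseteq> G"
  by (auto simp: trace_degrees_def dual_degrees_def)

lemma trace_degrees_add:
  assumes "t \<in> trace_degrees G" "g \<in> G" shows "t + g \<in> trace_degrees G"
  using assms canonical_degrees_add unfolding trace_degrees_def
  by (smt (verit) mem_Collect_eq)

text \<open>The smallest element of \<open>\<Omega>\<close> is \<open>- F\<close>. It therefore suffices that \<open>z + F\<close> maps \<open>\<Omega>\<close>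
  beyond \<open>F\<close>.\<close>

lemma trace_degrees_above:
  assumes "F < z" shows "z \<in> trace_degrees G"
proof -
  have "- F \<in> canonical_degrees G" using F_gap by (simp add: canonical_degrees_def)
  moreover have "z + F \<in> dual_degrees G"
    using assms canonical_degrees_ge above_F by (force simp: dual_degrees_def)
  ultimately show ?thesis unfolding trace_degrees_def by force
qed

lemma finite_semigroup_minus_trace: "finite (G - trace_degrees G)"
  by (rule finite_subset[of _ "{0..F}"]) (use nonneg trace_degrees_above in force)+

lemma standard_canonical_add:
  assumes "z \<in> standard_canonical G F" "g \<in> G" shows "z + g \<in> standard_canonical G F"
  using assms add[of "F - (z + g)" g] by (auto simp: standard_canonical_def)

lemma semigroup_subset_standard: "G \<subseteq> standard_canonical G F"
  using add[of "F - z" z for z] F_gap by (force simp: standard_canonical_def)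

lemma standard_canonical_nonneg: "z \<in> standard_canonical G F \<Longrightarrow> 0 \<le> z"
  using above_F[of "F - z"] by (force simp: standard_canonical_def)

lemma standard_minus_semigroup: "standard_canonical G F - G \<subseteq> {0..F}"
  using above_F standard_canonical_nonneg by force

end

section \<open>Weighted sums of sets of integers\<close>

definition weighted_sum :: "int \<Rightarrow> int \<Rightarrow> int set \<Rightarrow> int set \<Rightarrow> int set" where
  "weighted_sum m l A B = {m * a + l * b |a b. a \<in> A \<and> b \<in> B}"

lemma weighted_sum_commute: "weighted_sum m l A B = weighted_sum l m B A"
  unfolding weighted_sum_def by (auto simp: add.commute)

lemma weighted_sum_mono:
  "A' \<subseteq> A \<Longrightarrow> B' \<subseteq> B \<Longrightarrow> weighted_sum m l A' B' \<subseteq> weighted_sum m l A B"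
  unfolding weighted_sum_def by blast

lemma add_multiple_mem:
  fixes B :: "int set"
  assumes "\<And>b. b \<in> B \<Longrightarrow> b + m \<in> B" and "b \<in> B" and "0 \<le> k"
  shows "b + m * k \<in> B"
  using \<open>0 \<le> k\<close>
proof (induction k rule: int_ge_induct)
  case base thus ?case using assms by simp
next
  case (step k)
  thus ?case using assms(1)[OF step.IH] by (simp add: algebra_simps)
qed

text \<open>The Apery set with respect to \<open>m\<close>, for any set stable under adding \<open>m\<close>: the smallest
  elements of the residue classes modulo \<open>m\<close>.\<close>

definition apery :: "int \<Rightarrow> int set \<Rightarrow> int set" where
  "apery m B = {b \<in> B. b - m \<notin> B}"

lemma apery_decomposition:
  assumes "0 < m" and bound: "\<And>b. b \<in> B \<Longrightarrow> c \<le> b" and "b \<in> B"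
  obtains b' k where "b' \<in> apery m B" "0 \<le> k" "b = b' + m * k"
proof -
  have "\<exists>b' k. b' \<in> apery m B \<and> 0 \<le> k \<and> b = b' + m * k"
    using \<open>b \<in> B\<close>
  proof (induction "nat (b - c)" arbitrary: b rule: less_induct)
    case less
    show ?case
    proof (cases "b - m \<in> B")
      case False
      thus ?thesis using less.prems by (intro exI[of _ b] exI[of _ 0]) (auto simp: apery_def)
    next
      case True
      have "nat (b - m - c) < nat (b - c)" using bound[OF True] \<open>0 < m\<close> by simp
      from less.hyps[OF this True] obtain b' k
        where "b' \<in> apery m B" "0 \<le> k" "b - m = b' + m * k" by blast
      thus ?thesis by (intro exI[of _ b'] exI[of _ "k + 1"]) (auto simp: algebra_simps)
    qed
  qed
  thus thesis using that by blast
qed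

lemma apery_cong_eq:
  assumes "0 < m" and stable: "\<And>b. b \<in> B \<Longrightarrow> b + m \<in> B"
    and "b \<in> apery m B" "b' \<in> apery m B" and "m dvd b - b'"
  shows "b = b'"
proof -
  have le: "y \<le> x" if xy: "x \<in> apery m B" "y \<in> apery m B" "m dvd y - x" for x y
  proof (rule ccontr)
    assume "\<not> y \<le> x"
    from xy(3) obtain k where k: "y - x = m * k" ..
    have "0 < m * k" using k \<open>\<not> y \<le> x\<close> by simp
    hence "0 < k" using \<open>0 < m\<close> by (rule zero_less_mult_pos)
    hence "x + m * (k - 1) \<in> B"
      by (intro add_multiple_mem stable) (use xy(1) in \<open>simp_all add: apery_def\<close>)
    moreover have "x + m * (k - 1) = y - m" using k by (simp add: algebra_simps)
    ultimately show False using xy(2) by (simp add: apery_def)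
  qed
  have "m dvd b' - b" using assms(5) by (metis dvd_minus_iff minus_diff_eq)
  hence "b' \<le> b" by (rule le[OF assms(3,4)])
  moreover have "b \<le> b'" by (rule le[OF assms(4,3,5)])
  ultimately show ?thesis by simp
qed

lemma card_apery:
  assumes "0 < m" and stable: "\<And>b. b \<in> B \<Longrightarrow> b + m \<in> B"
    and bound: "\<And>b. b \<in> B \<Longrightarrow> c \<le> b" and above: "\<And>z. z > d \<Longrightarrow> z \<in> B"
  shows "card (apery m B) = nat m"
proof -
  have "bij_betw (\<lambda>b. b mod m) (apery m B) {0..<m}"
    unfolding bij_betw_def
  proof
    show "inj_on (\<lambda>b. b mod m) (apery m B)"
      by (rule inj_onI, rule apery_cong_eq[OF \<open>0 < m\<close>], erule stable)
        (simp_all add: mod_eq_dvd_iff)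
    show "(\<lambda>b. b mod m) ` apery m B = {0..<m}"
    proof
      show "(\<lambda>b. b mod m) ` apery m B \<subseteq> {0..<m}" using \<open>0 < m\<close> by auto
      show "{0..<m} \<subseteq> (\<lambda>b. b mod m) ` apery m B"
      proof
        fix r assume r: "r \<in> {0..<m}"
        have "\<bar>d\<bar> + 1 \<le> m * (\<bar>d\<bar> + 1)" using mult_right_mono[of 1 m "\<bar>d\<bar> + 1"] \<open>0 < m\<close> by simp
        hence "d < r + m * (\<bar>d\<bar> + 1)" using r unfolding atLeastLessThan_iff by linarith
        hence "r + m * (\<bar>d\<bar> + 1) \<in> B" by (rule above)
        then obtain b k where b: "b \<in> apery m B" and e: "r + m * (\<bar>d\<bar> + 1) = b + m * k"
          by (rule apery_decomposition[OF \<open>0 < m\<close> bound, rotated])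
        have "r mod m = b mod m" using e by (metis mod_mult_self2)
        hence "r = b mod m" using r by simp
        with b show "r \<in> (\<lambda>b. b mod m) ` apery m B" by blast
      qed
    qed
  qed
  from bij_betw_same_card[OF this] show ?thesis by simp
qed

text \<open>Freeness over the first summand. Multiples of \<open>m\<close> in the second coordinate can be moved to
  the first one, because \<open>m a + l (b + m k) = m (a + l k) + l b\<close>. So every element of the weighted
  sum has the form \<open>m a + l b\<close> with \<open>b\<close> in the Apery set, which has \<open>m\<close> elements, and this form is
  unique since \<open>l\<close> is invertible modulo \<open>m\<close>.\<close>

lemma card_weighted_sum_diff:
  assumes "0 < m" and "coprime l m"
    and A: "\<And>a. a \<in> A \<Longrightarrow> a + l \<in> A" and A': "\<And>a. a \<in> A' \<Longrightarrow> a + l \<in> A'"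
    and B: "\<And>b. b \<in> B \<Longrightarrow> b + m \<in> B"
    and bound: "\<And>b. b \<in> B \<Longrightarrow> c \<le> b" and above: "\<And>z. z > d \<Longrightarrow> z \<in> B"
  shows "card (weighted_sum m l A B - weighted_sum m l A' B) = nat m * card (A - A')"
proof -
  let ?f = "\<lambda>(a, b). m * a + l * b"
  have inj: "inj_on ?f (UNIV \<times> apery m B)"
  proof (rule inj_onI; clarify)
    fix a b a' b'
    assume b: "b \<in> apery m B" "b' \<in> apery m B" and e: "m * a + l * b = m * a' + l * b'"
    have "l * (b - b') = m * (a' - a)" using e by (simp add: algebra_simps)
    hence "m dvd l * (b - b')" by simp
    hence "m dvd b - b'" using \<open>coprime l m\<close>
      by (simp add: coprime_dvd_mult_right_iff coprime_commute)
    hence "b = b'" by (rule apery_cong_eq[OF \<open>0 < m\<close> B b, rotated])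
    with e \<open>0 < m\<close> show "a = a' \<and> b = b'" by simp
  qed
  have image: "weighted_sum m l X B = ?f ` (X \<times> apery m B)"
    if X: "\<And>a. a \<in> X \<Longrightarrow> a + l \<in> X" for X
  proof
    show "?f ` (X \<times> apery m B) \<subseteq> weighted_sum m l X B"
      by (auto simp: weighted_sum_def apery_def)
    show "weighted_sum m l X B \<subseteq> ?f ` (X \<times> apery m B)"
    proof
      fix n assume "n \<in> weighted_sum m l X B"
      then obtain a b where ab: "a \<in> X" "b \<in> B" "n = m * a + l * b"
        by (auto simp: weighted_sum_def)
      obtain b' k where b': "b' \<in> apery m B" "0 \<le> k" "b = b' + m * k"
        by (rule apery_decomposition[OF \<open>0 < m\<close> bound ab(2)])
      have "a + l * k \<in> X" by (intro add_multiple_mem X ab(1) b'(2))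
      moreover have "n = ?f (a + l * k, b')" using ab(3) b'(3) by (simp add: algebra_simps)
      ultimately show "n \<in> ?f ` (X \<times> apery m B)" using b'(1) by blast
    qed
  qed
  have images: "weighted_sum m l A B = ?f ` (A \<times> apery m B)"
    "weighted_sum m l A' B = ?f ` (A' \<times> apery m B)"
    by (rule image, erule A, rule image, erule A')
  have "weighted_sum m l A B - weighted_sum m l A' B
      = ?f ` (A \<times> apery m B - A' \<times> apery m B)"
    unfolding images
    by (rule inj_on_image_set_diff[OF inj, symmetric]) auto
  also have "A \<times> apery m B - A' \<times> apery m B = (A - A') \<times> apery m B" by auto
  finally have "card (weighted_sum m l A B - weighted_sum m l A' B)
      = card ((A - A') \<times> apery m B)"
    by (simp only: card_image[OF inj_on_subset[OF inj Sigma_mono[OF subset_UNIV subset_refl]]])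
  thus ?thesis using card_apery[OF \<open>0 < m\<close> B bound above] by (simp add: card_cartesian_product)
qed

section \<open>The canonical and trace degrees of a gluing\<close>

locale int_gluing =
  G1: int_semigroup G1 F1 + G2: int_semigroup G2 F2
  for G1 F1 G2 F2 +
  fixes l m :: int
  assumes l: "0 < l" "l \<in> G1" and m: "0 < m" "m \<in> G2" and coprime: "coprime l m"
begin

abbreviation "G \<equiv> weighted_sum m l G1 G2"
abbreviation "F \<equiv> m * F1 + l * F2 + l * m"

text \<open>Every integer is \<open>m a + l b\<close> with \<open>b\<close> in the Apery set of \<open>G2\<close>, and it is a gap exactly if
  \<open>a\<close> is one. Then \<open>b - m\<close> is a gap of \<open>G2\<close>, which explains the summand \<open>l m\<close>.\<close>

lemma gap_iff: "n \<notin> G \<longleftrightarrow> (\<exists>a b. a \<notin> G1 \<and> b \<notin> G2 \<and> n = m * a + l * b + l * m)"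
proof
  assume n: "n \<notin> G"
  obtain u v where uv: "u * l + v * m = 1" using coprime bezout_int[of l m] by auto
  have rep: "n = m * (v * n - l * j) + l * (u * n + m * j)" for j
  proof -
    have "m * (v * n - l * j) + l * (u * n + m * j) = n * (u * l + v * m)"
      by (simp add: algebra_simps)
    thus ?thesis using uv by simp
  qed
  \<comment> \<open>large enough for the second coordinate to lie beyond all gaps of \<open>G2\<close>\<close>
  define j where "j = \<bar>F2\<bar> + \<bar>u * n\<bar> + 1"
  have "j \<le> m * j" using mult_right_mono[of 1 m j] m(1) by (simp add: j_def)
  moreover have "F2 < u * n + j" by (simp add: j_def)
  ultimately have "F2 < u * n + m * j" by linarith
  hence "u * n + m * j \<in> G2" by (rule G2.above_F)
  then obtain b k where b: "b \<in> apery m G2" "u * n + m * j = b + m * k"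
    by (rule apery_decomposition[OF m(1) G2.nonneg, rotated])
  let ?a = "v * n - l * j + l * k"
  have "n = m * (v * n - l * j) + l * (b + m * k)" by (rule rep[of j, unfolded b(2)])
  also have "\<dots> = m * ?a + l * b" by (simp add: algebra_simps)
  finally have e: "n = m * ?a + l * b" .
  have "?a \<notin> G1" using n e b(1) by (auto simp: weighted_sum_def apery_def)
  moreover have "b - m \<notin> G2" using b(1) by (simp add: apery_def)
  moreover have "n = m * ?a + l * (b - m) + l * m"
    by (subst e) (simp add: algebra_simps)
  ultimately show "\<exists>a b. a \<notin> G1 \<and> b \<notin> G2 \<and> n = m * a + l * b + l * m" by blast
next
  assume "\<exists>a b. a \<notin> G1 \<and> b \<notin> G2 \<and> n = m * a + l * b + l * m"
  then obtain a b where ab: "a \<notin> G1" "b \<notin> G2" "n = m * a + l * b + l * m" by blast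
  show "n \<notin> G"
  proof
    assume "n \<in> G"
    then obtain x y where xy: "x \<in> G1" "y \<in> G2" "n = m * x + l * y"
      by (auto simp: weighted_sum_def)
    have e: "m * (a - x) = l * (y - b - m)" using ab(3) xy(3) by (simp add: algebra_simps)
    hence "l dvd m * (a - x)" by simp
    hence "l dvd a - x" using coprime by (simp add: coprime_dvd_mult_right_iff)
    then obtain k where k: "a - x = l * k" ..
    with e have "l * (m * k) = l * (y - b - m)" by (simp add: algebra_simps)
    hence k': "y - b - m = m * k" using l(1) by simp
    \<comment> \<open>\<open>a = x + l k\<close> and \<open>b = y + m (- k - 1)\<close>: one of the two multipliers is nonnegative\<close>
    show False
    proof (cases "0 \<le> k")
      case True
      hence "x + l * k \<in> G1" using add_multiple_mem[of G1 l x k] G1.add l(2) xy(1) by blast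
      thus False using k ab(1) by (simp add: algebra_simps)
    next
      case False
      hence "y + m * (- k - 1) \<in> G2"
        using add_multiple_mem[of G2 m y "- k - 1"] G2.add m(2) xy(2) by auto
      moreover have "y + m * (- k - 1) = b" using k' by (simp add: algebra_simps)
      ultimately show False using ab(2) by simp
    qed
  qed
qed

sublocale int_semigroup G F
proof
  show "0 \<in> G" using G1.zero G2.zero by (force simp: weighted_sum_def)
  show "a + b \<in> G" if "a \<in> G" "b \<in> G" for a b
  proof -
    from that obtain x y x' y' where "x \<in> G1" "x' \<in> G1" "y \<in> G2" "y' \<in> G2"
      "a = m * x + l * y" "b = m * x' + l * y'" by (auto simp: weighted_sum_def)
    moreover from this have "a + b = m * (x + x') + l * (y + y')" by (simp add: algebra_simps)
    ultimately show ?thesis unfolding weighted_sum_def using G1.add G2.add by blast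
  qed
  show "0 \<le> a" if "a \<in> G" for a
    using that G1.nonneg G2.nonneg l m by (auto simp: weighted_sum_def)
  show "F \<notin> G" unfolding gap_iff using G1.F_gap G2.F_gap by blast
  show "z \<in> G" if "F < z" for z
  proof (rule ccontr)
    assume "z \<notin> G"
    then obtain a b where ab: "a \<notin> G1" "b \<notin> G2" "z = m * a + l * b + l * m"
      unfolding gap_iff by blast
    hence "a \<le> F1" "b \<le> F2" using G1.above_F G2.above_F by force+
    hence "m * a \<le> m * F1" "l * b \<le> l * F2" using l m by simp_all
    with ab(3) that show False by simp
  qed
qed

lemma standard_canonical_gluing:
  "standard_canonical G F = weighted_sum m l (standard_canonical G1 F1) (standard_canonical G2 F2)"
  (is "?L = ?R")
proof
  show "?L \<subseteq> ?R"
  proof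
    fix z assume "z \<in> ?L"
    hence "F - z \<notin> G" by (simp add: standard_canonical_def)
    then obtain a b where ab: "a \<notin> G1" "b \<notin> G2" "F - z = m * a + l * b + l * m"
      unfolding gap_iff by blast
    have "z = m * (F1 - a) + l * (F2 - b)" using ab(3) by (simp add: algebra_simps)
    moreover have "F1 - a \<in> standard_canonical G1 F1" "F2 - b \<in> standard_canonical G2 F2"
      using ab by (auto simp: standard_canonical_def)
    ultimately show "z \<in> ?R" unfolding weighted_sum_def by blast
  qed
  show "?R \<subseteq> ?L"
  proof
    fix z assume "z \<in> ?R"
    then obtain a b where ab: "F1 - a \<notin> G1" "F2 - b \<notin> G2" "z = m * a + l * b"
      by (auto simp: weighted_sum_def standard_canonical_def)
    have "F - z = m * (F1 - a) + l * (F2 - b) + l * m" using ab(3) by (simp add: algebra_simps)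
    with ab have "F - z \<notin> G" unfolding gap_iff by blast
    thus "z \<in> ?L" by (simp add: standard_canonical_def)
  qed
qed

text \<open>The shift by \<open>- l m\<close> here is cancelled by a shift by \<open>l m\<close> of the dual degrees, so it
  does not affect the trace.\<close>

lemma canonical_degrees_gluing:
  "w \<in> canonical_degrees G \<longleftrightarrow>
     (\<exists>a\<in>canonical_degrees G1. \<exists>b\<in>canonical_degrees G2. w = m * a + l * b - l * m)"
proof -
  have "w \<in> canonical_degrees G \<longleftrightarrow>
      (\<exists>a b. a \<notin> G1 \<and> b \<notin> G2 \<and> - w = m * a + l * b + l * m)"
    by (simp add: canonical_degrees_def gap_iff)
  also have "\<dots> \<longleftrightarrow> (\<exists>a b. - a \<notin> G1 \<and> - b \<notin> G2 \<and> - w = m * (- a) + l * (- b) + l * m)"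
    by (metis minus_minus)
  also have "\<dots> \<longleftrightarrow> (\<exists>a\<in>canonical_degrees G1. \<exists>b\<in>canonical_degrees G2. w = m * a + l * b - l * m)"
    unfolding canonical_degrees_def by (auto simp: algebra_simps; force simp: algebra_simps)
  finally show ?thesis .
qed

lemma trace_degrees_gluing:
  "weighted_sum m l (trace_degrees G1) (trace_degrees G2) \<subseteq> trace_degrees G"
proof
  fix n assume "n \<in> weighted_sum m l (trace_degrees G1) (trace_degrees G2)"
  then obtain d w d' w' where
    d: "d \<in> dual_degrees G1" "d' \<in> dual_degrees G2" and
    w: "w \<in> canonical_degrees G1" "w' \<in> canonical_degrees G2" and
    n: "n = m * (d + w) + l * (d' + w')"
    by (auto simp: weighted_sum_def trace_degrees_def)
  have "m * d + l * d' + l * m \<in> dual_degrees G"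
    unfolding dual_degrees_def
  proof (clarify)
    fix x assume "x \<in> canonical_degrees G"
    then obtain a b where ab: "a \<in> canonical_degrees G1" "b \<in> canonical_degrees G2"
      "x = m * a + l * b - l * m" unfolding canonical_degrees_gluing by blast
    have "m * d + l * d' + l * m + x = m * (d + a) + l * (d' + b)"
      using ab(3) by (simp add: algebra_simps)
    moreover have "d + a \<in> G1" "d' + b \<in> G2" using d ab by (auto simp: dual_degrees_def)
    ultimately show "m * d + l * d' + l * m + x \<in> G" unfolding weighted_sum_def by blast
  qed
  moreover have "m * w + l * w' - l * m \<in> canonical_degrees G"
    unfolding canonical_degrees_gluing using w by blast
  moreover have "n = (m * d + l * d' + l * m) + (m * w + l * w' - l * m)"
    using n by (simp add: algebra_simps)
  ultimately show "n \<in> trace_degrees G" unfolding trace_degrees_def by blast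
qed

text \<open>Passing from \<open>m A + l B\<close> first to \<open>m A' + l B\<close> and then to \<open>m A' + l B'\<close>, one summand
  changes at a time, and freeness over \<open>G1\<close> and over \<open>G2\<close> counts the elements lost. Finiteness,
  which holds because \<open>A'\<close> and \<open>B'\<close> contain all large integers, is needed to add the two counts.\<close>

lemma card_weighted_sum_diff_both:
  assumes "A' \<subseteq> A" "B' \<subseteq> B"
    and A: "\<And>a g. a \<in> A \<Longrightarrow> g \<in> G1 \<Longrightarrow> a + g \<in> A"
    and A': "\<And>a g. a \<in> A' \<Longrightarrow> g \<in> G1 \<Longrightarrow> a + g \<in> A'"
    and B: "\<And>b g. b \<in> B \<Longrightarrow> g \<in> G2 \<Longrightarrow> b + g \<in> B"
    and B': "\<And>b g. b \<in> B' \<Longrightarrow> g \<in> G2 \<Longrightarrow> b + g \<in> B'"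
    and bounds: "\<And>a. a \<in> A \<Longrightarrow> 0 \<le> a" "\<And>b. b \<in> B \<Longrightarrow> 0 \<le> b"
    and above: "\<And>z. z > F1 \<Longrightarrow> z \<in> A'" "\<And>z. z > F2 \<Longrightarrow> z \<in> B'"
  shows "card (weighted_sum m l A B - weighted_sum m l A' B')
    = nat m * card (A - A') + nat l * card (B - B')"
    and "finite (weighted_sum m l A B - weighted_sum m l A' B')"
proof -
  have 1: "card (weighted_sum m l A B - weighted_sum m l A' B) = nat m * card (A - A')"
  proof (rule card_weighted_sum_diff[where c = 0 and d = F2])
    show "z \<in> B" if "z > F2" for z using above(2)[OF that] assms(2) by blast
  qed (use l m coprime A A' B bounds in auto)
  have "card (weighted_sum l m B A' - weighted_sum l m B' A') = nat l * card (B - B')"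
  proof (rule card_weighted_sum_diff[where c = 0 and d = F1])
    show "0 \<le> a" if "a \<in> A'" for a using that bounds(1) assms(1) by blast
  qed (use l m coprime A' B B' above in \<open>auto simp: coprime_commute\<close>)
  hence 2: "card (weighted_sum m l A' B - weighted_sum m l A' B') = nat l * card (B - B')"
    by (simp add: weighted_sum_commute)
  have sub: "weighted_sum m l A' B' \<subseteq> weighted_sum m l A' B"
    "weighted_sum m l A' B \<subseteq> weighted_sum m l A B"
    using weighted_sum_mono[of A' A' B' B] weighted_sum_mono[of A' A B B] assms(1,2) by auto
  have nonneg: "x \<ge> 0" if "x \<in> weighted_sum m l A B" for x
    using that bounds l m by (auto simp: weighted_sum_def)
  have "x \<in> weighted_sum m l A' B'" if "x > F + m * (\<bar>F1\<bar> + 1) + l * (\<bar>F2\<bar> + 1)" for x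
  proof -
    have "x - m * (\<bar>F1\<bar> + 1) - l * (\<bar>F2\<bar> + 1) \<in> G" using that by (intro above_F) simp
    then obtain a b where ab: "a \<in> G1" "b \<in> G2"
      "x - m * (\<bar>F1\<bar> + 1) - l * (\<bar>F2\<bar> + 1) = m * a + l * b"
      by (auto simp: weighted_sum_def)
    hence "x = m * (\<bar>F1\<bar> + 1 + a) + l * (\<bar>F2\<bar> + 1 + b)" by (simp add: algebra_simps)
    moreover have "\<bar>F1\<bar> + 1 + a \<in> A'" "\<bar>F2\<bar> + 1 + b \<in> B'"
      using ab above A' B' by simp_all
    ultimately show ?thesis unfolding weighted_sum_def by blast
  qed
  hence "weighted_sum m l A B - weighted_sum m l A' B'
      \<subseteq> {0..F + m * (\<bar>F1\<bar> + 1) + l * (\<bar>F2\<bar> + 1)}" using nonneg by force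
  thus finite: "finite (weighted_sum m l A B - weighted_sum m l A' B')"
    by (rule finite_subset) simp
  have "weighted_sum m l A B - weighted_sum m l A' B' =
      (weighted_sum m l A B - weighted_sum m l A' B) \<union>
      (weighted_sum m l A' B - weighted_sum m l A' B')" using sub by blast
  also have "card \<dots> = card (weighted_sum m l A B - weighted_sum m l A' B)
      + card (weighted_sum m l A' B - weighted_sum m l A' B')"
    using finite sub by (intro card_Un_disjoint) (auto intro: finite_subset[OF _ finite])
  finally show "card (weighted_sum m l A B - weighted_sum m l A' B')
    = nat m * card (A - A') + nat l * card (B - B')" using 1 2 by simp
qed

lemma card_semigroup_minus_trace_le:
  "card (G - trace_degrees G)
     \<le> nat m * card (G1 - trace_degrees G1) + nat l * card (G2 - trace_degrees G2)"
proof -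
  let ?S = "weighted_sum m l (trace_degrees G1) (trace_degrees G2)"
  have eq: "card (G - ?S)
      = nat m * card (G1 - trace_degrees G1) + nat l * card (G2 - trace_degrees G2)"
    and fin: "finite (G - ?S)"
    by ((rule card_weighted_sum_diff_both;
        (rule G1.trace_degrees_subset G2.trace_degrees_subset | erule (1) G1.add G2.add
          G1.trace_degrees_add G2.trace_degrees_add | erule G1.nonneg G2.nonneg
          G1.trace_degrees_above G2.trace_degrees_above)))+
  have "card (G - trace_degrees G) \<le> card (G - ?S)"
    by (rule card_mono[OF fin]) (use trace_degrees_gluing in blast)
  thus ?thesis by (simp only: eq)
qed

lemma card_standard_minus_semigroup:
  "card (standard_canonical G F - G)
     = nat m * card (standard_canonical G1 F1 - G1) + nat l * card (standard_canonical G2 F2 - G2)"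
  unfolding standard_canonical_gluing
  by (rule card_weighted_sum_diff_both;
      (rule G1.semigroup_subset_standard G2.semigroup_subset_standard | erule (1) G1.add G2.add
        G1.standard_canonical_add G2.standard_canonical_add | erule G1.standard_canonical_nonneg
        G2.standard_canonical_nonneg G1.above_F G2.above_F))

end

section \<open>Laurent polynomials with prescribed support\<close>

abbreviation t_pow :: "int \<Rightarrow> 'k::field laurent" where
  "t_pow n \<equiv> Poly_Mapping.single n 1"

definition supported :: "int set \<Rightarrow> 'k::field laurent set" where
  "supported A = {f. Poly_Mapping.keys f \<subseteq> A}"

lemma semigroup_ring_supported: "semigroup_ring H = supported (int ` H)"
  by (simp add: semigroup_ring_def supported_def)

lemma supported_iff: "f \<in> supported A \<longleftrightarrow> (\<forall>k. k \<notin> A \<longrightarrow> Poly_Mapping.lookup f k = 0)"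
  by (auto simp: supported_def in_keys_iff)

lemma supported_zero: "0 \<in> supported A"
  by (simp add: supported_iff)

lemma supported_add: "f \<in> supported A \<Longrightarrow> g \<in> supported A \<Longrightarrow> f + g \<in> supported A"
  by (simp add: supported_iff lookup_add)

lemma supported_single: "k \<in> A \<Longrightarrow> Poly_Mapping.single k c \<in> supported A"
  by (auto simp: supported_iff lookup_single when_def)

lemma supported_mult:
  assumes "f \<in> supported A" "g \<in> supported B" "\<And>a b. a \<in> A \<Longrightarrow> b \<in> B \<Longrightarrow> a + b \<in> C"
  shows "f * g \<in> supported C"
  using assms keys_mult[of f g] by (fastforce simp: supported_def)

lemma supported_disjoint:
  assumes "f \<in> supported A" "f \<in> supported B" "A \<inter> B = {}"
  shows "f = 0"
proof (rule poly_mapping_eqI)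
  fix k
  have "k \<notin> A \<or> k \<notin> B" using assms(3) by blast
  thus "Poly_Mapping.lookup f k = Poly_Mapping.lookup 0 k"
    using assms(1,2) by (auto simp: supported_iff)
qed

lemma lookup_single_times:
  fixes f :: "'k::field laurent"
  shows "Poly_Mapping.lookup (Poly_Mapping.single k c * f) j = c * Poly_Mapping.lookup f (j - k)"
proof -
  have inner: "(\<Sum>q. Poly_Mapping.lookup f q when j = i + q) = Poly_Mapping.lookup f (j - i)" for i
  proof -
    have "(\<Sum>q. Poly_Mapping.lookup f q when j = i + q)
        = (\<Sum>q. Poly_Mapping.lookup f q when q = j - i)"
      by (intro Sum_any.cong) (auto simp: when_def)
    thus ?thesis by simp
  qed
  have "Poly_Mapping.lookup (Poly_Mapping.single k c * f) j
      = (\<Sum>i. c * Poly_Mapping.lookup f (j - i) when i = k)"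
    unfolding lookup_mult inner
    by (intro Sum_any.cong) (auto simp: lookup_single when_def)
  thus ?thesis by simp
qed

lemma lookup_laurent_scale:
  "Poly_Mapping.lookup (laurent_scale c f) j = c * Poly_Mapping.lookup f j"
  by (simp add: laurent_scale_def lookup_single_times)

lemma laurent_expansion:
  "f = (\<Sum>k\<in>Poly_Mapping.keys f. Poly_Mapping.single k (Poly_Mapping.lookup f k))"
proof (rule poly_mapping_eqI)
  fix j
  show "Poly_Mapping.lookup f j = Poly_Mapping.lookup
    (\<Sum>k\<in>Poly_Mapping.keys f. Poly_Mapping.single k (Poly_Mapping.lookup f k)) j"
    by (auto simp: lookup_sum lookup_single when_def in_keys_iff)
qed

lemma subspace_supported: "laurent.subspace (supported A)"
  by (auto simp: laurent.subspace_def supported_iff lookup_add lookup_laurent_scale)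

definition restrict_support :: "int set \<Rightarrow> 'k::field laurent \<Rightarrow> 'k laurent" where
  "restrict_support C f = (\<Sum>k\<in>C. Poly_Mapping.single k (Poly_Mapping.lookup f k))"

lemma lookup_restrict_support:
  "finite C \<Longrightarrow> Poly_Mapping.lookup (restrict_support C f) j
     = (if j \<in> C then Poly_Mapping.lookup f j else 0)"
  by (simp add: restrict_support_def lookup_sum lookup_single when_def)

lemma linear_restrict_support:
  assumes "finite C"
  shows "Vector_Spaces.linear laurent_scale laurent_scale
    (restrict_support C :: 'k::field laurent \<Rightarrow> 'k laurent)"
proof
  fix f g :: "'k laurent" and c :: 'k
  show "restrict_support C (f + g) = restrict_support C f + restrict_support C g"
    by (rule poly_mapping_eqI) (simp add: lookup_restrict_support[OF assms] lookup_add)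
  show "restrict_support C (laurent_scale c f) = laurent_scale c (restrict_support C f)"
    by (rule poly_mapping_eqI) (simp add: lookup_restrict_support[OF assms] lookup_laurent_scale)
qed

lemma inj_t_pow: "inj (t_pow :: int \<Rightarrow> 'k::field laurent)"
  by (rule injI) (metis lookup_single_eq lookup_single_not_eq zero_neq_one)

lemma independent_t_pow:
  assumes "finite C"
  shows "laurent.independent (t_pow ` C :: 'k::field laurent set)"
proof (rule laurent.independent_if_scalars_zero)
  fix u :: "'k laurent \<Rightarrow> 'k" and x :: "'k laurent"
  assume z: "(\<Sum>x\<in>t_pow ` C. laurent_scale (u x) x) = 0" and "x \<in> t_pow ` C"
  then obtain k where k: "k \<in> C" "x = t_pow k" by blast
  have inj: "inj_on (t_pow :: int \<Rightarrow> 'k laurent) C"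
    using inj_t_pow by (rule inj_on_subset) simp
  have "0 = Poly_Mapping.lookup (\<Sum>x\<in>t_pow ` C. laurent_scale (u x) x) k" using z by simp
  also have "\<dots> = (\<Sum>i\<in>C. u (t_pow i) * (1 when i = k))"
    by (simp add: sum.reindex[OF inj] lookup_sum lookup_laurent_scale lookup_single)
  also have "\<dots> = (\<Sum>i\<in>C. u (t_pow i) when i = k)"
    by (intro sum.cong) (auto simp: when_def)
  also have "\<dots> = u x" using k assms by (simp add: when_def)
  finally show "u x = 0" by simp
qed (use assms in simp)

lemma dim_supported:
  assumes "finite C"
  shows "laurent.dim (supported C :: 'k::field laurent set) = card C"
proof -
  have inj: "inj_on (t_pow :: int \<Rightarrow> 'k laurent) C"
    using inj_t_pow by (rule inj_on_subset) simp
  show ?thesis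
  proof (rule laurent.dim_unique)
    show "t_pow ` C \<subseteq> (supported C :: 'k laurent set)" by (auto intro: supported_single)
    show "supported C \<subseteq> laurent.span (t_pow ` C :: 'k laurent set)"
    proof
      fix f :: "'k laurent" assume "f \<in> supported C"
      hence "Poly_Mapping.single k (Poly_Mapping.lookup f k) \<in> laurent.span (t_pow ` C)"
        if "k \<in> Poly_Mapping.keys f" for k
        using that laurent.span_scale[OF laurent.span_base,
            of "t_pow k" "t_pow ` C" "Poly_Mapping.lookup f k"]
        by (auto simp: laurent_scale_def mult_single supported_def)
      thus "f \<in> laurent.span (t_pow ` C)"
        by (subst laurent_expansion) (rule laurent.span_sum)
    qed
  qed (use assms inj independent_t_pow card_image in auto)
qed

section \<open>Dimensions of quotients\<close>

lemma quotient_basis_t_pow: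
  assumes "B \<subseteq> A" and "finite (A - B)"
  shows "quotient_basis (supported A) (supported B) (t_pow ` (A - B) :: 'k::field laurent set)"
  unfolding quotient_basis_def
proof (intro conjI allI impI)
  let ?C = "A - B"
  let ?S = "t_pow ` ?C :: 'k laurent set"
  show "?S \<subseteq> supported A" by (auto intro: supported_single)
  show "supported A \<subseteq> {w + s |w s. w \<in> supported B \<and> s \<in> laurent.span ?S}"
  proof
    fix f :: "'k laurent" assume f: "f \<in> supported A"
    have "f - restrict_support ?C f \<in> supported B"
      using f by (auto simp: supported_iff lookup_minus lookup_restrict_support[OF assms(2)])
    moreover have "restrict_support ?C f \<in> laurent.span ?S"
      unfolding restrict_support_def
    proof (rule laurent.span_sum)
      fix k assume "k \<in> ?C"
      thus "Poly_Mapping.single k (Poly_Mapping.lookup f k) \<in> laurent.span ?S"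
        using laurent.span_scale[OF laurent.span_base, of "t_pow k" ?S "Poly_Mapping.lookup f k"]
        by (simp add: laurent_scale_def mult_single)
    qed
    moreover have "f = (f - restrict_support ?C f) + restrict_support ?C f" by simp
    ultimately show "f \<in> {w + s |w s. w \<in> supported B \<and> s \<in> laurent.span ?S}" by blast
  qed
  fix X and u :: "'k laurent \<Rightarrow> 'k"
  assume X: "finite X" "X \<subseteq> ?S" and W: "(\<Sum>b\<in>X. laurent_scale (u b) b) \<in> supported B"
  have "(\<Sum>b\<in>X. laurent_scale (u b) b) \<in> supported ?C"
    using X by (intro laurent.subspace_sum subspace_supported laurent.subspace_scale)
      (auto intro: supported_single)
  with W have "(\<Sum>b\<in>X. laurent_scale (u b) b) = 0" by (rule supported_disjoint) blast
  thus "\<forall>b\<in>X. u b = 0"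
    using laurent.independentD[OF independent_t_pow[OF assms(2)] X] by blast
qed

text \<open>Restricting supports to \<open>A - B\<close> is linear with kernel \<open>supported B\<close> on \<open>supported A\<close>, so it
  carries any basis of the quotient to a basis of the space \<open>supported (A - B)\<close>, all of whose
  bases have the same size.\<close>

lemma quotient_basis_card:
  fixes S :: "'k::field laurent set"
  assumes "B \<subseteq> A" and fin: "finite (A - B)" and "quotient_basis (supported A) (supported B) S"
  shows "card S = card (A - B)"
proof -
  define \<pi> :: "'k laurent \<Rightarrow> 'k laurent" where "\<pi> = restrict_support (A - B)"
  interpret \<pi>: Vector_Spaces.linear laurent_scale laurent_scale \<pi>
    unfolding \<pi>_def by (rule linear_restrict_support[OF fin])
  have kernel: "f \<in> supported B" if "f \<in> supported A" "\<pi> f = 0" for f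
    unfolding supported_iff
  proof (intro allI impI)
    fix k assume "k \<notin> B"
    have "Poly_Mapping.lookup (\<pi> f) k = 0" using that(2) by simp
    thus "Poly_Mapping.lookup f k = 0"
      using \<open>k \<notin> B\<close> that(1)
      by (auto simp: \<pi>_def lookup_restrict_support[OF fin] supported_iff split: if_splits)
  qed
  have zero: "\<pi> f = 0" if "f \<in> supported B" for f
    using that by (intro poly_mapping_eqI)
      (auto simp: \<pi>_def lookup_restrict_support[OF fin] supported_iff)
  have fixed: "\<pi> f = f" if "f \<in> supported (A - B)" for f
    using that by (intro poly_mapping_eqI)
      (auto simp: \<pi>_def lookup_restrict_support[OF fin] supported_iff)
  have image: "\<pi> f \<in> supported (A - B)" for f
    by (auto simp: \<pi>_def lookup_restrict_support[OF fin] supported_iff)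
  from assms(3) have S: "S \<subseteq> supported A"
    and gen: "supported A \<subseteq> {w + s |w s. w \<in> supported B \<and> s \<in> laurent.span S}"
    and ind: "\<And>X u. finite X \<Longrightarrow> X \<subseteq> S \<Longrightarrow> (\<Sum>b\<in>X. laurent_scale (u b) b) \<in> supported B
      \<Longrightarrow> \<forall>b\<in>X. u b = 0"
    unfolding quotient_basis_def by auto
  have ind': "\<forall>b\<in>X. u b = 0"
    if "finite X" "X \<subseteq> S" "(\<Sum>b\<in>X. laurent_scale (u b) (\<pi> b)) = 0" for X u
  proof (rule ind[OF that(1,2)], rule kernel)
    show "(\<Sum>b\<in>X. laurent_scale (u b) b) \<in> supported A"
      using that S by (intro laurent.subspace_sum subspace_supported laurent.subspace_scale) auto
    show "\<pi> (\<Sum>b\<in>X. laurent_scale (u b) b) = 0"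
      using that(3) by (simp add: \<pi>.sum \<pi>.scale)
  qed
  have inj: "inj_on \<pi> S"
  proof (rule inj_onI, rule ccontr)
    fix x y assume xy: "x \<in> S" "y \<in> S" "\<pi> x = \<pi> y" "x \<noteq> y"
    define u :: "'k laurent \<Rightarrow> 'k" where "u b = (if b = x then 1 else - 1)" for b
    have "(\<Sum>b\<in>{x, y}. laurent_scale (u b) (\<pi> b)) = 0"
      using xy by (simp add: u_def)
    from ind'[OF _ _ this] xy have "u x = 0" by simp
    thus False by (simp add: u_def)
  qed
  have "laurent.independent (\<pi> ` S)"
    unfolding laurent.independent_explicit_finite_subsets
  proof (intro allI impI)
    fix Y and u :: "'k laurent \<Rightarrow> 'k"
    assume "Y \<subseteq> \<pi> ` S" and "finite Y" and z: "(\<Sum>v\<in>Y. laurent_scale (u v) v) = 0"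
    from finite_subset_image[OF \<open>finite Y\<close> \<open>Y \<subseteq> \<pi> ` S\<close>]
    obtain X where X: "finite X" "X \<subseteq> S" "Y = \<pi> ` X" by blast
    have "(\<Sum>b\<in>X. laurent_scale ((u \<circ> \<pi>) b) (\<pi> b)) = 0"
      using z unfolding X(3) sum.reindex[OF inj_on_subset[OF inj X(2)]] by (simp add: comp_def)
    from ind'[OF X(1,2) this] show "\<forall>v\<in>Y. u v = 0" by (simp add: X(3))
  qed
  moreover have "supported (A - B) \<subseteq> laurent.span (\<pi> ` S)"
  proof
    fix f :: "'k laurent" assume f: "f \<in> supported (A - B)"
    hence "f \<in> supported A" by (auto simp: supported_iff)
    then obtain w s where ws: "f = w + s" "w \<in> supported B" "s \<in> laurent.span S" using gen by blast
    have "f = \<pi> s" using fixed[OF f] zero[OF ws(2)] ws(1) by (simp add: \<pi>.add)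
    thus "f \<in> laurent.span (\<pi> ` S)" using ws(3) by (simp add: \<pi>.span_image)
  qed
  moreover have "\<pi> ` S \<subseteq> supported (A - B)" using image by blast
  ultimately have "card (\<pi> ` S) = laurent.dim (supported (A - B) :: 'k laurent set)"
    by (intro laurent.basis_card_eq_dim)
  thus ?thesis using dim_supported[OF fin, where 'k = 'k] card_image[OF inj] by simp
qed

lemma quotient_dim_supported:
  assumes "B \<subseteq> A" and "finite (A - B)"
  shows "quotient_dim (supported A :: 'k::field laurent set) (supported B) = card (A - B)"
proof -
  have "quotient_basis (supported A) (supported B)
    (SOME S :: 'k laurent set. quotient_basis (supported A) (supported B) S)"
    using quotient_basis_t_pow[OF assms]
    by (rule someI[of "quotient_basis (supported A) (supported B)"])
  from quotient_basis_card[OF assms this] show ?thesis by (simp only: quotient_dim_def)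
qed

section \<open>The canonical module and its trace\<close>

text \<open>The pairing \<open>(f, g) \<mapsto>\<close> constant coefficient of \<open>f g\<close>, which identifies the Laurent
  polynomials \<open>f\<close> supported in \<open>\<Omega>\<close> with the canonical module.\<close>

definition laurent_functional :: "'k::field laurent \<Rightarrow> 'k laurent \<Rightarrow> 'k" where
  "laurent_functional f = (\<lambda>g. Poly_Mapping.lookup (f * g) 0)"

lemma laurent_functional_t_pow:
  "laurent_functional f (t_pow n) = Poly_Mapping.lookup f (- n)"
  by (simp add: laurent_functional_def lookup_single_times mult.commute[of f])

lemma inj_laurent_functional:
  "inj (laurent_functional :: 'k::field laurent \<Rightarrow> 'k laurent \<Rightarrow> 'k)"
proof (rule injI)
  fix f g :: "'k laurent" assume eq: "laurent_functional f = laurent_functional g"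
  show "f = g"
  proof (rule poly_mapping_eqI)
    fix k
    show "Poly_Mapping.lookup f k = Poly_Mapping.lookup g k"
      using fun_cong[OF eq, of "t_pow (- k)"] by (simp only: laurent_functional_t_pow minus_minus)
  qed
qed

lemma laurent_functional_add:
  "laurent_functional (f + g) = laurent_functional f + laurent_functional g"
  by (rule ext) (simp only: laurent_functional_def plus_fun_apply distrib_right lookup_add)

lemma dual_action_laurent_functional:
  "dual_action r (laurent_functional f) = laurent_functional (r * f)"
  by (simp add: dual_action_def laurent_functional_def mult_ac)

lemma linear_laurent_functional:
  "Vector_Spaces.linear laurent_scale (*) (laurent_functional f :: 'k::field laurent \<Rightarrow> 'k)"
proof -
  have "laurent_functional f (laurent_scale c g) = c * laurent_functional f g" for c g
    by (simp add: laurent_functional_def laurent_scale_def lookup_single_times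
        mult.left_commute[of f])
  moreover have "vector_space ((*) :: 'k \<Rightarrow> 'k \<Rightarrow> 'k)"
    by unfold_locales (simp_all add: algebra_simps)
  ultimately show ?thesis
    unfolding Vector_Spaces.linear_def module_hom_def module_hom_axioms_def module_iff_vector_space
    by (simp add: laurent.vector_space_axioms laurent_functional_def distrib_left lookup_add)
qed

lemma linear_eq_laurent_functional:
  assumes "Vector_Spaces.linear laurent_scale (*) (\<psi> :: 'k::field laurent \<Rightarrow> 'k)"
    and "\<And>k. Poly_Mapping.lookup f k = \<psi> (t_pow (- k))"
  shows "\<psi> = laurent_functional f"
proof
  fix g :: "'k laurent"
  interpret \<psi>: Vector_Spaces.linear laurent_scale "(*)" \<psi> by (rule assms(1))
  interpret L: Vector_Spaces.linear laurent_scale "(*)" "laurent_functional f"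
    by (rule linear_laurent_functional)
  have eq: "\<psi> (Poly_Mapping.single k c) = laurent_functional f (Poly_Mapping.single k c)" for k c
  proof -
    have single: "Poly_Mapping.single k c = laurent_scale c (t_pow k)"
      by (simp add: laurent_scale_def mult_single)
    show ?thesis
      unfolding single \<psi>.scale L.scale by (simp add: laurent_functional_t_pow assms(2))
  qed
  let ?g = "\<Sum>k\<in>Poly_Mapping.keys g. Poly_Mapping.single k (Poly_Mapping.lookup g k)"
  have "\<psi> ?g = laurent_functional f ?g"
    unfolding \<psi>.sum L.sum by (intro sum.cong refl eq)
  thus "\<psi> g = laurent_functional f g" by (simp only: flip: laurent_expansion)
qed

lemma canonical_module_eq:
  "canonical_module H
     = laurent_functional ` (supported (canonical_degrees (int ` H)) :: 'k::field laurent set)"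
proof
  let ?\<Omega> = "canonical_degrees (int ` H)"
  show "canonical_module H \<subseteq> laurent_functional ` (supported ?\<Omega> :: 'k laurent set)"
  proof
    fix \<psi> :: "'k laurent \<Rightarrow> 'k" assume "\<psi> \<in> canonical_module H"
    hence lin: "Vector_Spaces.linear laurent_scale (*) \<psi>"
      and van: "\<And>f. f \<in> semigroup_ring H \<Longrightarrow> \<psi> f = 0"
      and fin: "finite {n. \<psi> (t_pow n) \<noteq> 0}" by (auto simp: canonical_module_def)
    define f where "f = Abs_poly_mapping (\<lambda>k. \<psi> (t_pow (- k)))"
    have "finite {k. \<psi> (t_pow (- k)) \<noteq> 0}"
      using finite_vimageI[OF fin, of uminus] by (simp add: vimage_def)
    hence f: "Poly_Mapping.lookup f k = \<psi> (t_pow (- k))" for k by (simp add: f_def)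
    have "f \<in> supported ?\<Omega>"
      unfolding supported_iff
      by (auto simp: f canonical_degrees_def semigroup_ring_supported intro!: van supported_single)
    moreover have "\<psi> = laurent_functional f" using linear_eq_laurent_functional lin f by blast
    ultimately show "\<psi> \<in> laurent_functional ` supported ?\<Omega>" by blast
  qed
  show "laurent_functional ` (supported ?\<Omega> :: 'k laurent set) \<subseteq> canonical_module H"
  proof clarify
    fix f :: "'k laurent" assume f: "f \<in> supported ?\<Omega>"
    have "laurent_functional f g = 0" if "g \<in> semigroup_ring H" for g
    proof -
      have "f * g \<in> supported (- {0})"
        using f that unfolding semigroup_ring_supported
      proof (rule supported_mult)
        fix a b assume ab: "a \<in> ?\<Omega>" "b \<in> int ` H"
        have "a + b \<noteq> 0"
        proof
          assume "a + b = 0"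
          hence "- a = b" by simp
          with ab show False by (simp add: canonical_degrees_def)
        qed
        thus "a + b \<in> - {0}" by simp
      qed
      thus ?thesis by (simp add: supported_iff laurent_functional_def)
    qed
    moreover have "finite {n. Poly_Mapping.lookup f (- n) \<noteq> 0}"
      using finite_vimageI[of "Poly_Mapping.keys f" uminus] by (simp add: vimage_def in_keys_iff)
    ultimately show "laurent_functional f \<in> canonical_module H"
      by (simp add: canonical_module_def linear_laurent_functional laurent_functional_t_pow)
  qed
qed

text \<open>The canonical module is a fractional ideal containing the unit \<open>t\<^sup>-\<^sup>F\<close>. After
  multiplication with a high power of \<open>t\<close>, both \<open>f\<close> and \<open>t\<^sup>-\<^sup>F\<close> become ring elements,
  which may be moved across a homomorphism. Comparing \<open>f \<cdot> t\<^sup>-\<^sup>F\<close> with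
  \<open>t\<^sup>-\<^sup>F \<cdot> f\<close> shows that the value at \<open>t\<^sup>-\<^sup>F\<close> determines the homomorphism, which
  need not be graded.\<close>

lemma canonical_hom_is_multiplication:
  fixes \<phi> :: "('k::field laurent \<Rightarrow> 'k) \<Rightarrow> 'k laurent"
  assumes "int_semigroup (int ` H) F"
    and \<phi>: "\<phi> \<in> hom_to_ring (semigroup_ring H) dual_action (canonical_module H)"
  obtains q where "q \<in> supported (dual_degrees (int ` H))"
    and "\<And>f. f \<in> supported (canonical_degrees (int ` H)) \<Longrightarrow> \<phi> (laurent_functional f) = f * q"
proof -
  interpret int_semigroup "int ` H" F by (rule assms(1))
  let ?\<Omega> = "canonical_degrees (int ` H)"
  let ?M = "canonical_module H :: ('k laurent \<Rightarrow> 'k) set"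
  have mem: "laurent_functional f \<in> ?M" if "f \<in> supported ?\<Omega>" for f
    using that by (simp add: canonical_module_eq)
  have hom: "\<phi> (laurent_functional (r * f)) = r * \<phi> (laurent_functional f)"
    if "r \<in> semigroup_ring H" "f \<in> supported ?\<Omega>" for r f
    using \<phi> that mem unfolding hom_to_ring_def by (simp flip: dual_action_laurent_functional)
  have F: "t_pow (- F) \<in> supported ?\<Omega>"
    using F_gap by (intro supported_single) (simp add: canonical_degrees_def)
  define q where "q = t_pow F * \<phi> (laurent_functional (t_pow (- F)))"
  have mult: "\<phi> (laurent_functional f) = f * q" if f: "f \<in> supported ?\<Omega>" for f
  proof -
    \<comment> \<open>the factor \<open>t_pow (2 * F + 1)\<close> moves \<open>\<Omega>\<close>, whose smallest element is \<open>- F\<close>, beyond \<open>F\<close>\<close>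
    have r: "t_pow (2 * F + 1) * f \<in> semigroup_ring H"
      unfolding semigroup_ring_supported
    proof (rule supported_mult[OF supported_single f])
      show "2 * F + 1 \<in> {2 * F + 1}" by simp
      show "a + b \<in> int ` H" if "a \<in> {2 * F + 1}" "b \<in> ?\<Omega>" for a b
        using canonical_degrees_ge[OF that(2)] that(1) by (intro above_F) simp
    qed
    have s: "t_pow (F + 1) \<in> semigroup_ring H"
      unfolding semigroup_ring_supported by (intro supported_single above_F) simp
    let ?x = "\<phi> (laurent_functional (t_pow (- F)))"
    have "t_pow (2 * F + 1) * f * t_pow (- F) = t_pow (2 * F + 1) * t_pow (- F) * f"
      by (simp only: mult_ac)
    also have "\<dots> = t_pow (F + 1) * f" by (simp add: mult_single)
    finally have comm: "t_pow (2 * F + 1) * f * t_pow (- F) = t_pow (F + 1) * f" .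
    have key: "t_pow (F + 1) * \<phi> (laurent_functional f) = t_pow (2 * F + 1) * f * ?x"
      using hom[OF r F] unfolding comm hom[OF s f] .
    have "\<phi> (laurent_functional f)
        = t_pow (- F - 1) * t_pow (F + 1) * \<phi> (laurent_functional f)"
      by (simp add: mult_single)
    also have "\<dots> = t_pow (- F - 1) * (t_pow (2 * F + 1) * f * ?x)"
      by (simp only: mult.assoc[of "t_pow (- F - 1)"] key)
    also have "\<dots> = f * (t_pow (- F - 1) * t_pow (2 * F + 1) * ?x)" by (simp only: mult_ac)
    also have "\<dots> = f * q" by (simp add: mult_single q_def)
    finally show ?thesis .
  qed
  moreover have "q \<in> supported (dual_degrees (int ` H))"
    unfolding supported_def mem_Collect_eq
  proof
    fix d assume d: "d \<in> Poly_Mapping.keys q"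
    show "d \<in> dual_degrees (int ` H)"
      unfolding dual_degrees_def mem_Collect_eq
    proof
      fix w assume w: "w \<in> ?\<Omega>"
      have "t_pow w * q \<in> semigroup_ring H"
        using \<phi> mem[OF supported_single[OF w]] unfolding hom_to_ring_def
        by (simp flip: mult[OF supported_single[OF w]])
      moreover have "Poly_Mapping.lookup (t_pow w * q) (d + w) \<noteq> 0"
        using d by (simp add: lookup_single_times in_keys_iff)
      ultimately show "d + w \<in> int ` H"
        unfolding semigroup_ring_supported supported_iff by blast
    qed
  qed
  ultimately show thesis using that by blast
qed

text \<open>Multiplication by \<open>q\<close> only produces exponents in \<open>trace_degrees\<close>; conversely the
  exponent \<open>d + w\<close> is attained when multiplication by \<open>t\<^sup>d\<close> is applied to \<open>t\<^sup>w\<close>.\<close>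

lemma canonical_trace_eq:
  assumes "int_semigroup (int ` H) F"
  shows "canonical_trace H = (supported (trace_degrees (int ` H)) :: 'k::field laurent set)"
proof
  let ?\<Omega> = "canonical_degrees (int ` H)"
  let ?T = "trace_degrees (int ` H)"
  let ?M = "canonical_module H :: ('k laurent \<Rightarrow> 'k) set"
  let ?Hom = "hom_to_ring (semigroup_ring H) dual_action ?M"
  have vals: "\<phi> \<psi> \<in> supported ?T" if "\<phi> \<in> ?Hom" "\<psi> \<in> ?M" for \<phi> \<psi>
  proof -
    obtain f where f: "f \<in> supported ?\<Omega>" "\<psi> = laurent_functional f"
      using \<open>\<psi> \<in> ?M\<close> by (auto simp: canonical_module_eq)
    obtain q where q: "q \<in> supported (dual_degrees (int ` H))" "\<phi> \<psi> = f * q"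
      using canonical_hom_is_multiplication[OF assms \<open>\<phi> \<in> ?Hom\<close>] f by metis
    have "q * f \<in> supported ?T"
      using q(1) f(1) by (rule supported_mult) (auto simp: trace_degrees_def)
    thus ?thesis by (simp add: q(2) mult.commute)
  qed
  have trace: "canonical_trace H = {sum_list xs |xs. set xs \<subseteq> (\<Union>\<phi>\<in>?Hom. \<phi> ` ?M)}"
    by (simp only: canonical_trace_def trace_ideal_def)
  have sums: "sum_list xs \<in> supported ?T" if "set xs \<subseteq> (\<Union>\<phi>\<in>?Hom. \<phi> ` ?M)" for xs
    using that
  proof (induction xs)
    case (Cons x xs)
    from Cons.prems have x: "x \<in> (\<Union>\<phi>\<in>?Hom. \<phi> ` ?M)"
      and xs: "set xs \<subseteq> (\<Union>\<phi>\<in>?Hom. \<phi> ` ?M)" by simp_all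
    from x vals have "x \<in> supported ?T" by blast
    thus ?case using Cons.IH[OF xs] by (simp add: supported_add)
  qed (simp add: supported_zero)
  show "canonical_trace H \<subseteq> (supported ?T :: 'k laurent set)"
  proof (rule subsetI)
    fix f :: "'k laurent" assume "f \<in> canonical_trace H"
    then obtain xs where "f = sum_list xs" "set xs \<subseteq> (\<Union>\<phi>\<in>?Hom. \<phi> ` ?M)"
      unfolding trace by (elim CollectE exE conjE)
    thus "f \<in> supported ?T" by (simp only: sums)
  qed
  have single: "Poly_Mapping.single k c \<in> (\<Union>\<phi>\<in>?Hom. \<phi> ` ?M)" if k: "k \<in> ?T" for k c
  proof -
    obtain d w where dw: "d \<in> dual_degrees (int ` H)" "w \<in> ?\<Omega>" "k = d + w"
      using k by (auto simp: trace_degrees_def)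
    define \<phi> where "\<phi> \<psi> = t_pow d * inv laurent_functional \<psi>" for \<psi> :: "'k laurent \<Rightarrow> 'k"
    have \<phi>: "\<phi> (laurent_functional f) = t_pow d * f" for f
      by (simp add: \<phi>_def inv_f_f[OF inj_laurent_functional])
    have "t_pow d * f \<in> semigroup_ring H" if "f \<in> supported ?\<Omega>" for f :: "'k laurent"
      unfolding semigroup_ring_supported
    proof (rule supported_mult[OF supported_single that])
      show "d \<in> {d}" by simp
      show "a + b \<in> int ` H" if "a \<in> {d}" "b \<in> ?\<Omega>" for a b
        using that dw(1) by (simp add: dual_degrees_def)
    qed
    hence "\<phi> \<in> ?Hom"
      by (auto simp: hom_to_ring_def canonical_module_eq dual_action_laurent_functional \<phi>
          distrib_left mult.left_commute simp flip: laurent_functional_add)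
    moreover have "laurent_functional (Poly_Mapping.single w c) \<in> ?M"
      using dw(2) by (simp add: canonical_module_eq supported_single)
    moreover have "Poly_Mapping.single k c = \<phi> (laurent_functional (Poly_Mapping.single w c))"
      by (simp add: \<phi> mult_single dw(3))
    ultimately show ?thesis by blast
  qed
  show "(supported ?T :: 'k laurent set) \<subseteq> canonical_trace H"
  proof
    fix f :: "'k laurent" assume f: "f \<in> supported ?T"
    let ?xs = "map (\<lambda>k. Poly_Mapping.single k (Poly_Mapping.lookup f k))
      (sorted_list_of_set (Poly_Mapping.keys f))"
    have "sum_list ?xs
        = (\<Sum>k\<in>Poly_Mapping.keys f. Poly_Mapping.single k (Poly_Mapping.lookup f k))"
      by (simp add: sum_list_distinct_conv_sum_set)
    hence "f = sum_list ?xs" by (simp only: flip: laurent_expansion)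
    moreover have "set ?xs \<subseteq> (\<Union>\<phi>\<in>?Hom. \<phi> ` ?M)"
    proof
      fix y assume "y \<in> set ?xs"
      then obtain k where "k \<in> Poly_Mapping.keys f"
        and y: "y = Poly_Mapping.single k (Poly_Mapping.lookup f k)" by auto
      with f have "k \<in> ?T" by (auto simp: supported_def)
      thus "y \<in> (\<Union>\<phi>\<in>?Hom. \<phi> ` ?M)" unfolding y by (rule single)
    qed
    ultimately show "f \<in> canonical_trace H"
      unfolding trace by (intro CollectI exI[of _ ?xs] conjI)
  qed
qed

lemma semigroup_residue_eq:
  assumes "int_semigroup (int ` H) F"
  shows "semigroup_residue TYPE('k::field) H = card (int ` H - trace_degrees (int ` H))"
proof -
  interpret int_semigroup "int ` H" F by (rule assms)
  show ?thesis
    unfolding semigroup_residue_def canonical_trace_eq[OF assms] semigroup_ring_supported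
    by (rule quotient_dim_supported[OF trace_degrees_subset finite_semigroup_minus_trace])
qed

section \<open>Genus, residue and gluings\<close>

lemma add_submonoid_generated: "add_submonoid (generated_monoid A)"
  unfolding generated_monoid_def by (rule hull_in) (auto simp: add_submonoid_def)

lemma generated_monoid_superset: "A \<subseteq> generated_monoid A"
  unfolding generated_monoid_def by (rule hull_subset)

lemma generated_monoid_minimal: "A \<subseteq> X \<Longrightarrow> add_submonoid X \<Longrightarrow> generated_monoid A \<subseteq> X"
  unfolding generated_monoid_def by (rule hull_minimal)

lemma generated_monoid_gluing:
  "int ` generated_monoid ((*) m ` A \<union> (*) l ` B)
     = weighted_sum (int m) (int l) (int ` generated_monoid A) (int ` generated_monoid B)"
proof -
  let ?X = "generated_monoid ((*) m ` A \<union> (*) l ` B)"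
  let ?Y = "{m * a + l * b |a b. a \<in> generated_monoid A \<and> b \<in> generated_monoid B}"
  note zero = add_submonoid_generated[unfolded add_submonoid_def, THEN conjunct1]
  note add = add_submonoid_generated[unfolded add_submonoid_def, THEN conjunct2, rule_format]
  have "?X = ?Y"
  proof
    show "?X \<subseteq> ?Y"
    proof (rule generated_monoid_minimal)
      show "(*) m ` A \<union> (*) l ` B \<subseteq> ?Y"
        using generated_monoid_superset[of A] generated_monoid_superset[of B]
          zero[of A] zero[of B] by force
      have "(m * a + l * b) + (m * a' + l * b') \<in> ?Y"
        if "a \<in> generated_monoid A" "b \<in> generated_monoid B"
          "a' \<in> generated_monoid A" "b' \<in> generated_monoid B" for a b a' b'
      proof -
        have "(m * a + l * b) + (m * a' + l * b') = m * (a + a') + l * (b + b')"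
          by (simp add: algebra_simps)
        thus ?thesis using add that by blast
      qed
      thus "add_submonoid ?Y"
        using zero[of A] zero[of B] unfolding add_submonoid_def by force
    qed
    have scaled: "generated_monoid C \<subseteq> {c. k * c \<in> ?X}" if "(*) k ` C \<subseteq> ?X" for C k
    proof (rule generated_monoid_minimal)
      show "add_submonoid {c. k * c \<in> ?X}"
        using zero add by (simp add: add_submonoid_def distrib_left)
    qed (use that in auto)
    have "generated_monoid A \<subseteq> {a. m * a \<in> ?X}" "generated_monoid B \<subseteq> {b. l * b \<in> ?X}"
      using generated_monoid_superset[of "(*) m ` A \<union> (*) l ` B"]
      by (intro scaled, simp)+
    thus "?Y \<subseteq> ?X" using add by blast
  qed
  hence "int ` ?X = {int (m * a + l * b) |a b. a \<in> generated_monoid A \<and> b \<in> generated_monoid B}"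
    by (simp only:) blast
  thus ?thesis unfolding weighted_sum_def by (simp only: of_nat_add of_nat_mult) blast
qed

text \<open>More than one minimal generator excludes \<open>1\<close>, so there are gaps and \<open>Max\<close> is taken over a
  nonempty set.\<close>

lemma numerical_semigroup_int:
  assumes "numerical_semigroup H"
  shows "int_semigroup (int ` H) (int (frobenius_number H))"
proof -
  from assms obtain A where H: "add_submonoid H" and fin: "finite (UNIV - H)"
    and A: "minimal_generators A H" "card A > 1"
    unfolding numerical_semigroup_def by blast
  have "1 \<notin> H"
  proof
    assume "1 \<in> H"
    have "1 \<in> A"
    proof (rule ccontr)
      assume "1 \<notin> A"
      hence "generated_monoid A \<subseteq> - {1}"
        by (intro generated_monoid_minimal) (auto simp: add_submonoid_def)
      with A(1) \<open>1 \<in> H\<close> show False unfolding minimal_generators_def by blast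
    qed
    moreover have "A \<noteq> {1}" using A(2) by auto
    ultimately have "generated_monoid {1} \<noteq> H" using A(1) unfolding minimal_generators_def by blast
    moreover have "n \<in> generated_monoid {1}" for n
      using add_submonoid_generated[of "{1}"] generated_monoid_superset[of "{1}"]
      by (induction n) (auto simp: add_submonoid_def)
    hence "generated_monoid {1} = UNIV" by blast
    moreover have "generated_monoid {1} \<subseteq> H"
      using \<open>1 \<in> H\<close> H by (intro generated_monoid_minimal) auto
    ultimately show False by blast
  qed
  hence "UNIV - H \<noteq> {}" by blast
  hence max1: "frobenius_number H \<notin> H"
    unfolding frobenius_number_def using Max_in[OF fin] by blast
  have max2: "x \<le> frobenius_number H" if "x \<notin> H" for x
    unfolding frobenius_number_def using that by (intro Max_ge fin) simp
  show ?thesis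
  proof
    show "0 \<in> int ` H" using H by (simp add: add_submonoid_def)
    show "a + b \<in> int ` H" if "a \<in> int ` H" "b \<in> int ` H" for a b
    proof -
      from that obtain x y where "x \<in> H" "y \<in> H" "a = int x" "b = int y" by blast
      moreover from this have "a + b = int (x + y)" by simp
      ultimately show ?thesis using H unfolding add_submonoid_def by blast
    qed
    show "0 \<le> a" if "a \<in> int ` H" for a using that by auto
    show "int (frobenius_number H) \<notin> int ` H" using max1 by auto
    show "z \<in> int ` H" if "int (frobenius_number H) < z" for z
    proof -
      have "nat z \<in> H"
      proof (rule ccontr)
        assume "nat z \<notin> H"
        hence "nat z \<le> frobenius_number H" by (rule max2)
        with that show False by simp
      qed
      thus ?thesis using that by (intro image_eqI[of _ _ "nat z"]) auto
    qed
  qed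
qed

text \<open>The reflection \<open>x \<mapsto> F - x\<close> identifies the gaps with \<open>K \<inter> [0, F]\<close>, which contains
  \<open>G \<inter> [0, F]\<close>; outside the interval \<open>K\<close> and \<open>G\<close> agree.\<close>

lemma genus_minus_small_elements:
  assumes "int_semigroup (int ` H) (int F)"
  shows "int (semigroup_genus H) - int (small_elements H)
    = int (card (standard_canonical (int ` H) (int F) - int ` H))"
proof -
  interpret int_semigroup "int ` H" "int F" by (rule assms)
  let ?K = "standard_canonical (int ` H) (int F)"
  have F: "F \<notin> H" "\<And>x. x > F \<Longrightarrow> x \<in> H" using F_gap above_F[of "int x" for x]
    by (auto simp: inj_image_mem_iff[OF inj_of_nat])
  have gaps: "x \<le> F" if "x \<notin> H" for x using that F(2)[of x] by (cases "F < x") auto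
  hence fin: "finite (UNIV - H)" by (intro finite_subset[OF _ finite_atMost[of F]] subsetI) simp
  have frob: "frobenius_number H = F"
    unfolding frobenius_number_def using F(1) fin gaps by (intro Max_eqI) auto
  have "(\<lambda>x. int F - int x) ` (UNIV - H) = ?K \<inter> {0..int F}"
  proof
    show "(\<lambda>x. int F - int x) ` (UNIV - H) \<subseteq> ?K \<inter> {0..int F}"
      using gaps by (auto simp: standard_canonical_def inj_image_mem_iff[OF inj_of_nat])
    show "?K \<inter> {0..int F} \<subseteq> (\<lambda>x. int F - int x) ` (UNIV - H)"
    proof
      fix z assume z: "z \<in> ?K \<inter> {0..int F}"
      hence "int F - z \<notin> int ` H" "int F - z = int (nat (int F - z))"
        by (auto simp: standard_canonical_def)
      hence "nat (int F - z) \<notin> H" by (metis imageI)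
      thus "z \<in> (\<lambda>x. int F - int x) ` (UNIV - H)"
        using z by (intro image_eqI[of _ _ "nat (int F - z)"]) auto
    qed
  qed
  hence "card (?K \<inter> {0..int F}) = card ((\<lambda>x. int F - int x) ` (UNIV - H))" by simp
  also have "\<dots> = semigroup_genus H"
    unfolding semigroup_genus_def by (intro card_image) (auto simp: inj_on_def)
  finally have g: "card (?K \<inter> {0..int F}) = semigroup_genus H" .
  have "int ` {s \<in> H. s < F} = int ` H \<inter> {0..int F}"
  proof
    show "int ` {s \<in> H. s < F} \<subseteq> int ` H \<inter> {0..int F}" by auto
    show "int ` H \<inter> {0..int F} \<subseteq> int ` {s \<in> H. s < F}"
    proof
      fix z assume "z \<in> int ` H \<inter> {0..int F}"
      then obtain s where "s \<in> H" "s \<le> F" "z = int s" by auto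
      moreover from this have "s < F" using F(1) by (cases "s = F") auto
      ultimately show "z \<in> int ` {s \<in> H. s < F}" by blast
    qed
  qed
  hence n: "card (int ` H \<inter> {0..int F}) = small_elements H"
    unfolding small_elements_def frob using card_image[of int "{s \<in> H. s < F}"] by simp
  have sub: "int ` H \<inter> {0..int F} \<subseteq> ?K \<inter> {0..int F}" using semigroup_subset_standard by blast
  have "?K - int ` H = (?K \<inter> {0..int F}) - (int ` H \<inter> {0..int F})"
    using standard_minus_semigroup by blast
  hence "card (?K - int ` H) = semigroup_genus H - small_elements H"
    using card_Diff_subset[OF _ sub] g n by simp
  moreover have "small_elements H \<le> semigroup_genus H"
    using card_mono[OF _ sub] g n by simp
  ultimately show ?thesis by simp
qed

theorem mainTheorem4:
  fixes \<Gamma>\<^sub>1 \<Gamma>\<^sub>2 \<Gamma> :: "nat set" and l m :: nat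
  assumes "numerical_semigroup \<Gamma>\<^sub>1" and "numerical_semigroup \<Gamma>\<^sub>2"
    and "is_gluing l m \<Gamma>\<^sub>1 \<Gamma>\<^sub>2 \<Gamma>"
    and "int (semigroup_residue TYPE('k::field) \<Gamma>\<^sub>1)
           \<le> int (semigroup_genus \<Gamma>\<^sub>1) - int (small_elements \<Gamma>\<^sub>1)"
    and "int (semigroup_residue TYPE('k) \<Gamma>\<^sub>2)
           \<le> int (semigroup_genus \<Gamma>\<^sub>2) - int (small_elements \<Gamma>\<^sub>2)"
  shows "int (semigroup_residue TYPE('k) \<Gamma>)
           \<le> int (semigroup_genus \<Gamma>) - int (small_elements \<Gamma>)"
proof -
  let ?G1 = "int ` \<Gamma>\<^sub>1" and ?G2 = "int ` \<Gamma>\<^sub>2" and ?G = "int ` \<Gamma>"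
  let ?F1 = "frobenius_number \<Gamma>\<^sub>1" and ?F2 = "frobenius_number \<Gamma>\<^sub>2"
  note s1 = numerical_semigroup_int[OF assms(1)] and s2 = numerical_semigroup_int[OF assms(2)]
  from assms(3) obtain M N where MN: "generated_monoid M = \<Gamma>\<^sub>1" "generated_monoid N = \<Gamma>\<^sub>2"
    and lm: "l \<in> \<Gamma>\<^sub>1" "m \<in> \<Gamma>\<^sub>2" "0 < l" "0 < m" "coprime l m"
    and \<Gamma>: "\<Gamma> = generated_monoid ((*) m ` M \<union> (*) l ` N)"
    unfolding is_gluing_def minimal_generators_def by blast
  have G: "?G = weighted_sum (int m) (int l) ?G1 ?G2"
    unfolding \<Gamma> generated_monoid_gluing MN ..
  interpret int_gluing ?G1 "int ?F1" ?G2 "int ?F2" "int l" "int m"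
    by (intro int_gluing.intro s1 s2 int_gluing_axioms.intro) (use lm in auto)
  let ?F = "m * ?F1 + l * ?F2 + l * m"
  have s: "int_semigroup ?G (int ?F)"
    using int_semigroup_axioms by (simp add: G)
  have "semigroup_residue TYPE('k) \<Gamma> = card (?G - trace_degrees ?G)"
    by (rule semigroup_residue_eq[OF s])
  also have "\<dots> \<le> m * card (?G1 - trace_degrees ?G1) + l * card (?G2 - trace_degrees ?G2)"
    using card_semigroup_minus_trace_le by (simp add: G)
  also have "\<dots> = m * semigroup_residue TYPE('k) \<Gamma>\<^sub>1 + l * semigroup_residue TYPE('k) \<Gamma>\<^sub>2"
    by (simp add: semigroup_residue_eq[OF s1] semigroup_residue_eq[OF s2])
  also have "\<dots> \<le> m * card (standard_canonical ?G1 ?F1 - ?G1)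
      + l * card (standard_canonical ?G2 ?F2 - ?G2)"
    using assms(4,5) genus_minus_small_elements[OF s1] genus_minus_small_elements[OF s2]
    by (intro add_mono mult_left_mono) simp_all
  also have "\<dots> = card (standard_canonical ?G ?F - ?G)"
    using card_standard_minus_semigroup by (simp add: G)
  finally show ?thesis using genus_minus_small_elements[OF s] by simp
qed

end
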